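(* There exists a real Banach space $X$ with the diametral local diameter 2 property (DLD2P) that contains no relative Daugavet-point.
   Context: All Banach spaces are real. $B_X$ and $S_X$ denote the closed unit ball and unit sphere of $X$. A slice of $B_X$ is a set of the form $S(x^*,\alpha)=\{y\in B_X:\ x^*(y)>\sup x^*(B_X)-\alpha\}$ with $x^*\in X^*$ and $\alpha>0$. For $x\in S_X$ let $D(x)=\{x^*\in S_{X^*}:\ x^*(x)=1\}$; a supporting slice at $x$ is a slice $S(x^*,\alpha)$ with $x^*\in D(x)$ and $\alpha>0$. A point $x\in S_X$ is a $\Delta$-point if $\sup_{y\in T}\|x-y\|=2$ for every slice $T$ of $B_X$ containing $x$. $X$ (with $X\neq\{0\}$) has the DLD2P if every $x\in S_X$ is a $\Delta$-point. A point $x\in S_X$ is a Daugavet-point relative to a supporting slice $S$ at $x$ if $\sup_{y\in T}\|x-y\|=2$ for every slice $T$ of $B_X$ with $T\subseteq S$, and a relative Daugavet-point if it is a Daugavet-point relative to some supporting slice at $x$. *)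

theory Defs
  imports Complex_Main "HOL-Algebra.Module"
begin

text \<open>
  HOL cannot quantify existentially over types, so Banach spaces are treated as objects: vector
  spaces on a carrier set in the sense of HOL-Algebra, equipped with a norm. Nothing is assumed
  about the operations outside the carrier, and the fields \<open>mult\<close> and \<open>one\<close> that
  the module record inherits from the ring record play no role. Fixing a type
  of elements only bounds the cardinality of the carrier: a space that is small enough can be
  transported into it along an injection.
\<close>

definition real_ring :: "real ring" where
  "real_ring = \<lparr>carrier = UNIV, monoid.mult = (*), one = 1, zero = 0, add = (+)\<rparr>"

record 'a normed_module = "(real, 'a) module" +
  vnorm :: "'a \<Rightarrow> real"

locale normed_space = Module.module real_ring X for X :: "'a normed_module" (structure) +
  assumes vnorm_nonneg: "x \<in> carrier X \<Longrightarrow> 0 \<le> vnorm X x"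
    and vnorm_eq_0_iff: "x \<in> carrier X \<Longrightarrow> vnorm X x = 0 \<longleftrightarrow> x = \<zero>"
    and vnorm_smult: "x \<in> carrier X \<Longrightarrow> vnorm X (c \<odot> x) = \<bar>c\<bar> * vnorm X x"
    and vnorm_triangle:
      "\<lbrakk>x \<in> carrier X; y \<in> carrier X\<rbrakk> \<Longrightarrow> vnorm X (x \<oplus> y) \<le> vnorm X x + vnorm X y"

locale banach_space = normed_space X for X :: "'a normed_module" (structure) +
  assumes complete:
    "\<lbrakk>\<And>n. u n \<in> carrier X;
      \<And>e. 0 < e \<Longrightarrow> \<exists>N. \<forall>m\<ge>N. \<forall>n\<ge>N. vnorm X (u m \<ominus> u n) < e\<rbrakk>
     \<Longrightarrow> \<exists>l\<in>carrier X. (\<lambda>n. vnorm X (u n \<ominus> l)) \<longlonglongrightarrow> 0"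

definition unit_ball :: "'a normed_module \<Rightarrow> 'a set" where
  "unit_ball X = {x \<in> carrier X. vnorm X x \<le> 1}"

definition unit_sphere :: "'a normed_module \<Rightarrow> 'a set" where
  "unit_sphere X = {x \<in> carrier X. vnorm X x = 1}"

text \<open>
  Functionals are total functions of which only the values on the carrier matter: two of them that
  agree on the carrier represent the same element of the dual space.
\<close>

definition dual_space :: "'a normed_module \<Rightarrow> ('a \<Rightarrow> real) set" where
  "dual_space X = {f.
     (\<forall>x\<in>carrier X. \<forall>y\<in>carrier X. f (x \<oplus>\<^bsub>X\<^esub> y) = f x + f y) \<and>
     (\<forall>c. \<forall>x\<in>carrier X. f (c \<odot>\<^bsub>X\<^esub> x) = c * f x) \<and>
     (\<exists>K. \<forall>x\<in>carrier X. \<bar>f x\<bar> \<le> K * vnorm X x)}"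

definition dual_norm :: "'a normed_module \<Rightarrow> ('a \<Rightarrow> real) \<Rightarrow> real" where
  "dual_norm X f = (SUP x\<in>unit_ball X. \<bar>f x\<bar>)"

definition slice :: "'a normed_module \<Rightarrow> ('a \<Rightarrow> real) \<Rightarrow> real \<Rightarrow> 'a set" where
  "slice X f \<alpha> = {y \<in> unit_ball X. f y > (SUP z\<in>unit_ball X. f z) - \<alpha>}"

definition is_slice :: "'a normed_module \<Rightarrow> 'a set \<Rightarrow> bool" where
  "is_slice X T \<longleftrightarrow> (\<exists>f\<in>dual_space X. \<exists>\<alpha>>0. T = slice X f \<alpha>)"

definition supporting_functionals :: "'a normed_module \<Rightarrow> 'a \<Rightarrow> ('a \<Rightarrow> real) set" where
  "supporting_functionals X x = {f \<in> dual_space X. dual_norm X f = 1 \<and> f x = 1}"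

definition is_supporting_slice :: "'a normed_module \<Rightarrow> 'a \<Rightarrow> 'a set \<Rightarrow> bool" where
  "is_supporting_slice X x S \<longleftrightarrow>
     (\<exists>f\<in>supporting_functionals X x. \<exists>\<alpha>>0. S = slice X f \<alpha>)"

definition delta_point :: "'a normed_module \<Rightarrow> 'a \<Rightarrow> bool" where
  "delta_point X x \<longleftrightarrow> x \<in> unit_sphere X \<and>
     (\<forall>T. is_slice X T \<and> x \<in> T \<longrightarrow> (SUP y\<in>T. vnorm X (x \<ominus>\<^bsub>X\<^esub> y)) = 2)"

definition DLD2P :: "'a normed_module \<Rightarrow> bool" where
  "DLD2P X \<longleftrightarrow> carrier X \<noteq> {\<zero>\<^bsub>X\<^esub>} \<and> (\<forall>x\<in>unit_sphere X. delta_point X x)"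

definition daugavet_point_relative_to :: "'a normed_module \<Rightarrow> 'a \<Rightarrow> 'a set \<Rightarrow> bool" where
  "daugavet_point_relative_to X x S \<longleftrightarrow> x \<in> unit_sphere X \<and> is_supporting_slice X x S \<and>
     (\<forall>T. is_slice X T \<and> T \<subseteq> S \<longrightarrow> (SUP y\<in>T. vnorm X (x \<ominus>\<^bsub>X\<^esub> y)) = 2)"

definition relative_daugavet_point :: "'a normed_module \<Rightarrow> 'a \<Rightarrow> bool" where
  "relative_daugavet_point X x \<longleftrightarrow> (\<exists>S. daugavet_point_relative_to X x S)"

end

theory Submission
  imports Defs "HOL-Analysis.Bounded_Continuous_Function"
begin

text \<open>
  The space is the Euclidean sum \<open>Z \<oplus>\<^sub>2 Z\<close>, where \<open>Z\<close> is the space of bounded continuous functions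
  on the line with the supremum norm.

  It has the DLD2P because \<open>Z\<close> has very flexible elements. Given \<open>u\<close> in \<open>Z\<close>, put many disjoint tents
  of height 1 into an interval on which \<open>\<bar>u\<bar>\<close> is almost maximal, and let \<open>\<phi>\<close> be the product of \<open>u\<close>
  with one of them. The function \<open>u - 2 \<phi>\<close> is not larger than \<open>u\<close> anywhere in absolute value, but it
  is almost at distance \<open>2 \<parallel>u\<parallel>\<close> from \<open>u\<close>. Signed sums of the functions \<open>\<phi>\<close> stay bounded by \<open>\<parallel>u\<parallel>\<close>, so a
  given functional is small on at least one of them if there are many (\<open>weakly_close_antipodes_bcontfun\<close>).
  Hence every slice containing \<open>u\<close> contains such a point \<open>u - 2 \<phi>\<close>. Working in both coordinates
  separately gives the same for \<open>Z \<oplus>\<^sub>2 Z\<close> (\<open>weakly_close_antipodes_Pair\<close>).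

  It has no relative Daugavet-point because the Euclidean norm of the plane is strictly convex and
  smooth. A norm-one functional \<open>f\<close> supporting \<open>x = (u, v)\<close> has the form \<open>(a F, b G)\<close> where \<open>F\<close>, \<open>G\<close>
  have norm one and \<open>(a, b) = (\<parallel>u\<parallel>, \<parallel>v\<parallel>)\<close>. Rotate \<open>(a, b)\<close> slightly to \<open>(s, t)\<close> on the quarter circle. A
  thin slice of \<open>g = (s F, t G)\<close> lies in the given slice of \<open>f\<close>, but all its points have coordinate
  norms close to \<open>(s, t)\<close>, so their distance from \<open>x\<close> is at most about \<open>\<parallel>(a, b) + (s, t)\<parallel> < 2\<close>
  (\<open>l2_sum_slice_away_from_antipode\<close>).

  Both arguments take place in a type of class \<open>banach\<close>; an injection into \<open>real \<Rightarrow> real\<close> then carries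
  the structure over to a normed module.
\<close>

section \<open>Almost antipodal points near a bounded continuous function\<close>

text \<open>
  In every weak neighbourhood of \<open>x\<close> given by one functional, there is a point \<open>x - 2 \<phi>\<close> of norm at
  most \<open>\<parallel>x\<parallel>\<close> that is almost as far from \<open>x\<close> as \<open>- x\<close> is. Recording the half difference \<open>\<phi>\<close> instead of
  the point lets the condition be checked in each coordinate of a sum separately.
\<close>

definition weakly_close_antipodes :: "'a::real_normed_vector \<Rightarrow> bool" where
  "weakly_close_antipodes x \<longleftrightarrow> (\<forall>g \<epsilon> \<delta>. bounded_linear g \<longrightarrow> 0 < \<epsilon> \<longrightarrow> \<epsilon> \<le> 1 \<longrightarrow> 0 < \<delta> \<longrightarrow>
     (\<exists>\<phi>. \<bar>g \<phi> :: real\<bar> < \<delta> \<and> norm (x - 2 *\<^sub>R \<phi>) \<le> norm x \<and> (1 - \<epsilon>) * norm x \<le> norm \<phi>))"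

lemma weakly_close_antipodesD:
  assumes "weakly_close_antipodes x" "bounded_linear g" "0 < \<epsilon>" "\<epsilon> \<le> 1" "0 < \<delta>"
  shows "\<exists>\<phi>. \<bar>g \<phi> :: real\<bar> < \<delta> \<and> norm (x - 2 *\<^sub>R \<phi>) \<le> norm x \<and> (1 - \<epsilon>) * norm x \<le> norm \<phi>"
  using assms unfolding weakly_close_antipodes_def by blast

lemma sum_disjoint_tents_le_1:
  fixes s :: real
  shows "(\<Sum>n<N. max 0 (1 - 2 * \<bar>s - real n\<bar>)) \<le> 1"
proof (cases "\<exists>m<N. \<bar>s - real m\<bar> < 1/2")
  case True
  then obtain m where m: "m < N" "\<bar>s - real m\<bar> < 1/2" by blast
  have "max 0 (1 - 2 * \<bar>s - real n\<bar>) = 0" if "n \<noteq> m" for n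
  proof -
    have "\<bar>real n - real m\<bar> \<ge> 1" using that by linarith
    moreover have "\<bar>real n - real m\<bar> \<le> \<bar>s - real n\<bar> + \<bar>s - real m\<bar>" by simp
    ultimately have "1 - 2 * \<bar>s - real n\<bar> \<le> 0" using m(2) by argo
    then show ?thesis by simp
  qed
  then have "(\<Sum>n\<in>{..<N} - {m}. max 0 (1 - 2 * \<bar>s - real n\<bar>)) = 0"
    by (intro sum.neutral) auto
  then have "(\<Sum>n<N. max 0 (1 - 2 * \<bar>s - real n\<bar>)) = max 0 (1 - 2 * \<bar>s - real m\<bar>)"
    using m(1) by (subst sum.remove[of _ m]) auto
  then show ?thesis by simp
next
  case False
  then have "max 0 (1 - 2 * \<bar>s - real n\<bar>) = 0" if "n < N" for n
  proof -
    have "1 / 2 \<le> \<bar>s - real n\<bar>" using False that not_less by blast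
    then show ?thesis by simp
  qed
  then have "(\<Sum>n<N. max 0 (1 - 2 * \<bar>s - real n\<bar>)) = 0"
    by (intro sum.neutral) auto
  then show ?thesis by simp
qed

text \<open>
  The tents multiplied into \<open>u\<close> sit at \<open>N\<close> equally spaced points to the right of an almost-maximum.
  Having disjoint supports, they span a copy of a finite-dimensional space with the maximum norm, so
  the values of a functional on them have a sum of absolute values bounded independently of \<open>N\<close>.
\<close>

lemma weakly_close_antipodes_bcontfun:
  fixes u :: "real \<Rightarrow>\<^sub>C real"
  shows "weakly_close_antipodes u"
  unfolding weakly_close_antipodes_def
proof (intro allI impI)
  fix g :: "(real \<Rightarrow>\<^sub>C real) \<Rightarrow> real" and \<epsilon> \<delta> :: real
  assume g: "bounded_linear g" and "0 < \<epsilon>" "0 < \<delta>"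
  show "\<exists>\<phi>. \<bar>g \<phi>\<bar> < \<delta> \<and> norm (u - 2 *\<^sub>R \<phi>) \<le> norm u \<and> (1 - \<epsilon>) * norm u \<le> norm \<phi>"
  proof (cases "u = 0")
    case True
    then show ?thesis
      using \<open>0 < \<delta>\<close> g by (intro exI[of _ 0]) (auto simp: linear_simps)
  next
    case False
    interpret g: bounded_linear g by fact
    obtain K where K: "0 < K" "\<And>x. norm (g x) \<le> norm x * K"
      using g.pos_bounded by blast
    have "\<exists>t. (1 - \<epsilon>) * norm u < \<bar>u t\<bar>"
    proof (rule ccontr)
      assume "\<not> ?thesis"
      then have "norm u \<le> (1 - \<epsilon>) * norm u"
        by (intro norm_bound) (auto simp: not_less)
      then show False using False mult_pos_pos[OF \<open>0 < \<epsilon>\<close>, of "norm u"] by (simp add: algebra_simps)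
    qed
    then obtain t0 where t0: "(1 - \<epsilon>) * norm u < \<bar>u t0\<bar>" by blast
    have "continuous_on UNIV (\<lambda>t. \<bar>u t\<bar>)"
      by (intro continuous_intros continuous_on_apply_bcontfun)
    then have "open {t. (1 - \<epsilon>) * norm u < \<bar>u t\<bar>}"
      by (intro open_Collect_less continuous_on_const)
    then obtain d where d: "0 < d" "cball t0 d \<subseteq> {t. (1 - \<epsilon>) * norm u < \<bar>u t\<bar>}"
      using t0 open_contains_cball by blast
    obtain N :: nat where N: "K * norm u / \<delta> < real N"
      using reals_Archimedean2 by blast
    have "0 < N"
      using N K(1) \<open>0 < \<delta>\<close> by (metis divide_nonneg_pos less_le_not_le mult_nonneg_nonneg norm_ge_zero not_gr0 of_nat_0)
    \<comment> \<open>The choice of \<open>N\<close> makes it impossible that all \<open>N\<close> values \<open>\<bar>g (\<phi> n)\<bar>\<close>, whose sum is at most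
      \<open>K \<parallel>u\<parallel>\<close>, reach \<open>\<delta>\<close>. The tent \<open>b n\<close> has its peak at \<open>t0 + d n / N\<close>, inside the interval.\<close>
    define b where "b n t = max 0 (1 - 2 * \<bar>(t - t0) * real N / d - real n\<bar>)" for n :: nat and t
    have b01: "0 \<le> b n t" "b n t \<le> 1" for n t
      by (auto simp: b_def)
    define \<phi> where "\<phi> n = Bcontfun (\<lambda>t. u t * b n t)" for n
    have bc: "(\<lambda>t. u t * b n t) \<in> bcontfun" for n
    proof (rule bcontfun_normI[where b = "norm u"])
      show "continuous_on UNIV (\<lambda>t. u t * b n t)"
        unfolding b_def using \<open>0 < d\<close> by (intro continuous_intros) auto
      fix t
      have "\<bar>u t\<bar> * b n t \<le> norm u * 1"
        using norm_bounded[of u t] b01 by (intro mult_mono) auto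
      then show "norm (u t * b n t) \<le> norm u"
        using b01 by (simp add: abs_mult)
    qed
    have \<phi>: "\<phi> n t = u t * b n t" for n t
      unfolding \<phi>_def by (simp add: Bcontfun_inverse bc)
    have \<phi>_refl: "norm (u - 2 *\<^sub>R \<phi> n) \<le> norm u" for n
    proof (rule norm_bound)
      fix t
      have "\<bar>u t * (1 - 2 * b n t)\<bar> \<le> \<bar>u t\<bar> * 1"
        unfolding abs_mult using b01[of n t] by (intro mult_left_mono) auto
      then show "norm (apply_bcontfun (u - 2 *\<^sub>R \<phi> n) t) \<le> norm u"
        using norm_bounded[of u t] by (simp add: \<phi> algebra_simps)
    qed
    have \<phi>_big: "(1 - \<epsilon>) * norm u \<le> norm (\<phi> n)" if "n < N" for n
    proof -
      define t where "t = t0 + d * (real n / real N)"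
      have "d * (real n / real N) \<le> d * 1"
        using that \<open>0 < d\<close> by (intro mult_left_mono) auto
      then have "t \<in> cball t0 d"
        using \<open>0 < d\<close> by (simp add: t_def dist_real_def)
      then have "(1 - \<epsilon>) * norm u < \<bar>u t\<bar>" using d(2) by blast
      moreover have "b n t = 1"
        using \<open>0 < d\<close> \<open>0 < N\<close> by (simp add: b_def t_def)
      then have "\<phi> n t = u t" by (simp add: \<phi>)
      ultimately show ?thesis using norm_bounded[of "\<phi> n" t] by simp
    qed
    \<comment> \<open>Choosing the signs according to \<open>g\<close> turns the sum of absolute values into one value of \<open>g\<close>,
      on a function that is bounded by \<open>\<bar>u\<bar>\<close> because the tents do not overlap.\<close>
    have "(\<Sum>n<N. \<bar>g (\<phi> n)\<bar>) = g (\<Sum>n<N. sgn (g (\<phi> n)) *\<^sub>R \<phi> n)"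
      by (simp add: g.sum g.scaleR abs_sgn mult.commute)
    also have "\<dots> \<le> norm (\<Sum>n<N. sgn (g (\<phi> n)) *\<^sub>R \<phi> n) * K"
      using K(2)[of "\<Sum>n<N. sgn (g (\<phi> n)) *\<^sub>R \<phi> n"] by simp
    also have "\<dots> \<le> norm u * K"
    proof (intro mult_right_mono norm_bound)
      fix t
      have apply_sum: "apply_bcontfun (\<Sum>n\<in>A. h n) t = (\<Sum>n\<in>A. h n t)"
        for A and h :: "nat \<Rightarrow> real \<Rightarrow>\<^sub>C real"
        by (induction A rule: infinite_finite_induct) auto
      have "\<bar>\<Sum>n<N. sgn (g (\<phi> n)) * \<phi> n t\<bar> \<le> (\<Sum>n<N. \<bar>u t\<bar> * b n t)"
        using b01 by (intro order_trans[OF sum_abs] sum_mono)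
          (auto simp: \<phi> abs_mult sgn_if)
      also have "\<dots> = \<bar>u t\<bar> * (\<Sum>n<N. b n t)" by (simp add: sum_distrib_left)
      also have "\<dots> \<le> \<bar>u t\<bar> * 1"
        unfolding b_def by (intro mult_left_mono sum_disjoint_tents_le_1) auto
      also have "\<dots> \<le> norm u" using norm_bounded[of u t] by simp
      finally show "norm (apply_bcontfun (\<Sum>n<N. sgn (g (\<phi> n)) *\<^sub>R \<phi> n) t) \<le> norm u"
        by (simp add: apply_sum)
    qed (use K in auto)
    finally have total: "(\<Sum>n<N. \<bar>g (\<phi> n)\<bar>) \<le> norm u * K" .
    have "\<exists>n<N. \<bar>g (\<phi> n)\<bar> < \<delta>"
    proof (rule ccontr)
      assume "\<not> ?thesis"
      then have "(\<Sum>n<N. \<delta>) \<le> (\<Sum>n<N. \<bar>g (\<phi> n)\<bar>)"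
        by (intro sum_mono) (metis lessThan_iff not_less)
      then have "real N * \<delta> \<le> K * norm u" using total by (simp add: mult.commute)
      then show False using N \<open>0 < \<delta>\<close> by (simp add: field_simps)
    qed
    then show ?thesis using \<phi>_refl \<phi>_big by blast
  qed
qed

lemma weakly_close_antipodes_Pair:
  fixes u :: "'a::real_normed_vector" and v :: "'b::real_normed_vector"
  assumes u: "weakly_close_antipodes u" and v: "weakly_close_antipodes v"
  shows "weakly_close_antipodes (u, v)"
  unfolding weakly_close_antipodes_def
proof (intro allI impI)
  fix g :: "'a \<times> 'b \<Rightarrow> real" and \<epsilon> \<delta> :: real
  assume g: "bounded_linear g" and "0 < \<epsilon>" "\<epsilon> \<le> 1" "0 < \<delta>"
  interpret g: bounded_linear g by fact
  have lin: "bounded_linear (\<lambda>y. g (y, 0))" "bounded_linear (\<lambda>z. g (0, z))"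
    by (intro bounded_linear_compose[OF g] bounded_linear_Pair bounded_linear_ident bounded_linear_zero)+
  note \<epsilon>\<delta> = \<open>0 < \<epsilon>\<close> \<open>\<epsilon> \<le> 1\<close> half_gt_zero[OF \<open>0 < \<delta>\<close>]
  obtain \<phi> \<psi> where
    \<phi>: "\<bar>g (\<phi>, 0)\<bar> < \<delta> / 2" "norm (u - 2 *\<^sub>R \<phi>) \<le> norm u" "(1 - \<epsilon>) * norm u \<le> norm \<phi>" and
    \<psi>: "\<bar>g (0, \<psi>)\<bar> < \<delta> / 2" "norm (v - 2 *\<^sub>R \<psi>) \<le> norm v" "(1 - \<epsilon>) * norm v \<le> norm \<psi>"
    using weakly_close_antipodesD[OF u lin(1) \<epsilon>\<delta>] weakly_close_antipodesD[OF v lin(2) \<epsilon>\<delta>] by blast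
  have "g (\<phi>, \<psi>) = g (\<phi>, 0) + g (0, \<psi>)"
    by (simp flip: g.add)
  then have "\<bar>g (\<phi>, \<psi>)\<bar> < \<delta>" using \<phi>(1) \<psi>(1) by simp
  moreover have "norm ((u, v) - 2 *\<^sub>R (\<phi>, \<psi>)) \<le> norm (u, v)"
    using \<phi>(2) \<psi>(2) by (simp add: norm_Pair power_mono add_mono)
  moreover have "(1 - \<epsilon>) * norm (u, v) \<le> norm (\<phi>, \<psi>)"
  proof -
    have "(1 - \<epsilon>) * norm (u, v) = norm ((1 - \<epsilon>) *\<^sub>R (u, v))"
      unfolding norm_scaleR using \<open>\<epsilon> \<le> 1\<close> by simp
    then show ?thesis
      using \<phi>(3) \<psi>(3) \<open>\<epsilon> \<le> 1\<close>
      by (simp add: norm_Pair del: norm_scaleR) (auto intro!: add_mono power_mono)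
  qed
  ultimately show "\<exists>\<phi>. \<bar>g \<phi>\<bar> < \<delta> \<and> norm ((u, v) - 2 *\<^sub>R \<phi>) \<le> norm (u, v) \<and>
      (1 - \<epsilon>) * norm (u, v) \<le> norm \<phi>" by blast
qed

section \<open>Supporting functionals of a Euclidean sum\<close>

lemma linear_bound_from_unit_ball:
  fixes h :: "'a::real_normed_vector \<Rightarrow> real"
  assumes "bounded_linear h" and le: "\<And>y. norm y \<le> 1 \<Longrightarrow> \<bar>h y\<bar> \<le> c"
  shows "\<bar>h y\<bar> \<le> c * norm y"
proof (cases "y = 0")
  case False
  interpret h: bounded_linear h by fact
  have "\<bar>h y\<bar> = norm y * \<bar>h (y /\<^sub>R norm y)\<bar>"
    using False by (simp add: h.scaleR abs_mult)
  also have "\<dots> \<le> norm y * c"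
    using False by (intro mult_left_mono le) auto
  finally show ?thesis by (simp add: mult.commute)
qed (use assms(1) in \<open>simp add: linear_simps\<close>)

text \<open>
  The dual of a Euclidean sum is the Euclidean sum of the duals. This direction follows by testing \<open>f\<close>
  at the vector \<open>(P y, Q z)\<close> whose weights are the values \<open>P = f (y, 0)\<close> and \<open>Q = f (0, z)\<close> themselves.
\<close>

lemma l2_sum_functional_components:
  fixes f :: "'a::real_normed_vector \<times> 'b::real_normed_vector \<Rightarrow> real"
  assumes f: "bounded_linear f" and f_le: "\<And>w. f w \<le> norm w"
    and y: "norm y \<le> 1" and z: "norm z \<le> 1"
  shows "(f (y, 0))\<^sup>2 + (f (0, z))\<^sup>2 \<le> 1"
proof -
  interpret f: bounded_linear f by fact
  define P Q where "P = f (y, 0)" and "Q = f (0, z)"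
  define r where "r = sqrt (P\<^sup>2 + Q\<^sup>2)"
  have "f (P *\<^sub>R y, Q *\<^sub>R z) = f (P *\<^sub>R (y, 0) + Q *\<^sub>R (0, z))" by simp
  also have "\<dots> = P\<^sup>2 + Q\<^sup>2"
    unfolding f.add f.scaleR by (simp add: P_def Q_def power2_eq_square)
  finally have "P\<^sup>2 + Q\<^sup>2 \<le> norm (P *\<^sub>R y, Q *\<^sub>R z)"
    using f_le[of "(P *\<^sub>R y, Q *\<^sub>R z)"] by simp
  also have "\<dots> \<le> r"
  proof -
    have "(norm y)\<^sup>2 \<le> 1" "(norm z)\<^sup>2 \<le> 1"
      using y z by (simp_all add: power_le_one)
    then have "P\<^sup>2 * (norm y)\<^sup>2 \<le> P\<^sup>2 * 1" "Q\<^sup>2 * (norm z)\<^sup>2 \<le> Q\<^sup>2 * 1"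
      by (intro mult_left_mono; simp)+
    then show ?thesis
      unfolding r_def norm_Pair by (simp add: power_mult_distrib)
  qed
  finally have "r\<^sup>2 \<le> r" by (simp add: r_def)
  moreover have "0 \<le> r" by (simp add: r_def)
  ultimately have "r \<le> 1"
    by (cases "r = 0") (auto simp: power2_eq_square)
  then have "r\<^sup>2 \<le> 1" using \<open>0 \<le> r\<close> by (simp add: power_le_one)
  then show ?thesis by (simp add: r_def P_def Q_def)
qed

text \<open>
  Smoothness of the circle: with \<open>a = \<parallel>u\<parallel>\<close>, \<open>b = \<parallel>v\<parallel>\<close>, the values \<open>P\<close>, \<open>Q\<close> of the two components of \<open>f\<close>
  at the normalised coordinates satisfy \<open>a P + b Q = 1\<close> and \<open>P\<^sup>2 + Q\<^sup>2 \<le> 1\<close>, which leaves only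
  \<open>(P, Q) = (a, b)\<close>. Since \<open>Q = b\<close>, the first component is bounded by \<open>a\<close> on the whole unit ball, and
  symmetrically for the second.
\<close>

lemma l2_sum_supporting_functional:
  fixes f :: "'a::real_normed_vector \<times> 'b::real_normed_vector \<Rightarrow> real"
  assumes f: "bounded_linear f" and f_le: "\<And>w. f w \<le> norm w"
    and uv: "norm (u, v) = 1" "f (u, v) = 1"
  shows "f (u, 0) = (norm u)\<^sup>2" "f (0, v) = (norm v)\<^sup>2"
    "\<bar>f (y, 0)\<bar> \<le> norm u * norm y" "\<bar>f (0, z)\<bar> \<le> norm v * norm z"
proof -
  interpret f: bounded_linear f by fact
  have lin: "bounded_linear (\<lambda>y. f (y, 0))" "bounded_linear (\<lambda>z. f (0, z))"
    by (intro bounded_linear_compose[OF f] bounded_linear_Pair bounded_linear_ident bounded_linear_zero)+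
  define a b where "a = norm u" and "b = norm v"
  have ab: "a\<^sup>2 + b\<^sup>2 = 1" using uv(1) by (simp add: norm_Pair a_def b_def)
  have ab0: "0 \<le> a" "0 \<le> b" by (simp_all add: a_def b_def)
  define U V where "U = u /\<^sub>R a" and "V = v /\<^sub>R b"
  \<comment> \<open>If a coordinate vanishes, then its normalisation is \<open>0\<close>, which has norm at most 1 as well.\<close>
  have UV1: "norm U \<le> 1" "norm V \<le> 1"
    by (cases "u = 0"; simp add: U_def a_def) (cases "v = 0"; simp add: V_def b_def)
  have u: "u = a *\<^sub>R U" and v: "v = b *\<^sub>R V"
    by (cases "u = 0"; simp add: U_def a_def) (cases "v = 0"; simp add: V_def b_def)
  define P Q where "P = f (U, 0)" and "Q = f (0, V)"
  have fu: "f (u, 0) = a * P"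
    unfolding P_def using f.scaleR[of a "(U, 0)"] by (simp flip: u)
  have fv: "f (0, v) = b * Q"
    unfolding Q_def using f.scaleR[of b "(0, V)"] by (simp flip: v)
  have "f (u, v) = f (u, 0) + f (0, v)" by (simp flip: f.add)
  then have "a * P + b * Q = 1" using uv fu fv by simp
  moreover have "P\<^sup>2 + Q\<^sup>2 \<le> 1"
    unfolding P_def Q_def by (intro l2_sum_functional_components f f_le UV1)
  ultimately have "(P - a)\<^sup>2 + (Q - b)\<^sup>2 \<le> 0"
    using ab by (simp add: power2_diff) (simp add: algebra_simps)
  then have PQ: "P = a" "Q = b"
    by (metis add_nonneg_eq_0_iff antisym zero_le_power2 add_nonneg_nonneg eq_iff_diff_eq_0 power_eq_0_iff)+
  show "f (u, 0) = (norm u)\<^sup>2" "f (0, v) = (norm v)\<^sup>2"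
    using fu fv PQ by (simp_all add: a_def b_def power2_eq_square)
  have "\<bar>f (y, 0)\<bar> \<le> a" if "norm y \<le> 1" for y
  proof -
    have "(f (y, 0))\<^sup>2 + Q\<^sup>2 \<le> 1"
      unfolding Q_def by (intro l2_sum_functional_components f f_le UV1 that)
    then have "(f (y, 0))\<^sup>2 \<le> a\<^sup>2" using PQ ab by simp
    then show ?thesis using ab0 by (metis abs_le_square_iff abs_of_nonneg)
  qed
  then show "\<bar>f (y, 0)\<bar> \<le> norm u * norm y"
    unfolding a_def by (intro linear_bound_from_unit_ball[OF lin(1)])
  have "\<bar>f (0, z)\<bar> \<le> b" if "norm z \<le> 1" for z
  proof -
    have "P\<^sup>2 + (f (0, z))\<^sup>2 \<le> 1"
      unfolding P_def by (intro l2_sum_functional_components f f_le UV1 that)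
    then have "(f (0, z))\<^sup>2 \<le> b\<^sup>2" using PQ ab by simp
    then show ?thesis using ab0 by (metis abs_le_square_iff abs_of_nonneg)
  qed
  then show "\<bar>f (0, z)\<bar> \<le> norm v * norm z"
    unfolding b_def by (intro linear_bound_from_unit_ball[OF lin(2)])
qed

definition norming_pair :: "'a::real_normed_vector \<Rightarrow> ('a \<Rightarrow> real) \<Rightarrow> bool" where
  "norming_pair U F \<longleftrightarrow> bounded_linear F \<and> norm U = 1 \<and> F U = 1 \<and> (\<forall>z. \<bar>F z\<bar> \<le> norm z)"

text \<open>
  If \<open>u = 0\<close>, then \<open>h = 0\<close> and there is nothing to normalise: any norm-attaining functional serves as the
  direction \<open>F\<close>. This is where the existence of one has to be assumed.
\<close>

lemma normalise_functional:
  fixes u :: "'a::real_normed_vector"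
  assumes h: "bounded_linear h" and hu: "h u = (norm u)\<^sup>2"
    and h_le: "\<And>z. \<bar>h z\<bar> \<le> norm u * norm z"
    and ex: "\<exists>U F. norming_pair (U :: 'a) F"
  shows "\<exists>U F. norming_pair (U :: 'a) F \<and> (\<forall>z. h z = norm u * F z)"
proof (cases "u = 0")
  case True
  then have "h z = 0" for z using h_le[of z] by simp
  then show ?thesis using ex True by auto
next
  case False
  interpret h: bounded_linear h by fact
  have "norming_pair (u /\<^sub>R norm u) (\<lambda>z. h z / norm u)"
    unfolding norming_pair_def
  proof (intro conjI allI)
    show "bounded_linear (\<lambda>z. h z / norm u)"
      using bounded_linear_compose[OF bounded_linear_divide h] .
    show "\<bar>h z / norm u\<bar> \<le> norm z" for z
      using h_le[of z] False by (simp add: field_simps)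
  qed (use False hu in \<open>auto simp: h.scaleR power2_eq_square\<close>)
  then show ?thesis using False by (intro exI conjI) auto
qed

section \<open>Rotated slices\<close>

text \<open>
  A rotation by a small angle \<open>h\<close>, in the direction that stays in the first quadrant; the chord is at
  most as long as the arc.
\<close>

lemma ex_nearby_point_on_quarter_circle:
  fixes a b :: real
  assumes "0 \<le> a" "0 \<le> b" "a\<^sup>2 + b\<^sup>2 = 1" "0 < \<eta>"
  shows "\<exists>s t. 0 \<le> s \<and> 0 \<le> t \<and> s\<^sup>2 + t\<^sup>2 = 1 \<and> a * s + b * t < 1 \<and> \<bar>a - s\<bar> + \<bar>b - t\<bar> \<le> \<eta>"
proof -
  obtain \<theta> where \<theta>: "0 \<le> \<theta>" "\<theta> \<le> pi/2" "a = cos \<theta>" "b = sin \<theta>"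
    using sincos_total_pi_half[OF assms(1-3)] by auto
  define h where "h = min (\<eta> / 2) (pi / 4)"
  have h: "0 < h" "h \<le> pi / 4" "h \<le> \<eta> / 2" using assms by (auto simp: h_def)
  define \<theta>' where "\<theta>' = (if \<theta> \<le> pi / 4 then \<theta> + h else \<theta> - h)"
  have \<theta>': "0 \<le> \<theta>'" "\<theta>' \<le> pi/2" "\<bar>\<theta> - \<theta>'\<bar> = h"
    using h \<theta> by (auto simp: \<theta>'_def)
  have "cos (\<theta> - \<theta>') = cos h" using \<theta>'(3) cos_abs_real by metis
  moreover have "cos h < cos 0" using h by (intro cos_monotone_0_pi) auto
  ultimately have "a * cos \<theta>' + b * sin \<theta>' < 1"
    using \<theta> by (simp add: cos_diff)
  moreover have "\<bar>cos \<theta> - cos \<theta>'\<bar> \<le> h" "\<bar>sin \<theta> - sin \<theta>'\<bar> \<le> h"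
  proof -
    have "(cos \<theta> - cos \<theta>')\<^sup>2 + (sin \<theta> - sin \<theta>')\<^sup>2
        = ((sin \<theta>)\<^sup>2 + (cos \<theta>)\<^sup>2) + ((sin \<theta>')\<^sup>2 + (cos \<theta>')\<^sup>2) - 2 * cos (\<theta> - \<theta>')"
      unfolding cos_diff by (simp only: power2_diff) (simp add: algebra_simps)
    also have "\<dots> = 2 - 2 * cos (2 * (h / 2))"
      using \<open>cos (\<theta> - \<theta>') = cos h\<close> by simp
    also have "\<dots> = (2 * sin (h / 2))\<^sup>2"
      unfolding cos_double_sin by (simp add: power_mult_distrib)
    also have "\<dots> \<le> h\<^sup>2"
      using abs_sin_x_le_abs_x[of "h / 2"] h by (intro iffD1[OF abs_le_square_iff]) simp
    finally have le: "(cos \<theta> - cos \<theta>')\<^sup>2 + (sin \<theta> - sin \<theta>')\<^sup>2 \<le> h\<^sup>2" .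
    have "(cos \<theta> - cos \<theta>')\<^sup>2 \<le> h\<^sup>2" "(sin \<theta> - sin \<theta>')\<^sup>2 \<le> h\<^sup>2"
      using le zero_le_power2[of "cos \<theta> - cos \<theta>'"] zero_le_power2[of "sin \<theta> - sin \<theta>'"]
      by linarith+
    then show "\<bar>cos \<theta> - cos \<theta>'\<bar> \<le> h" "\<bar>sin \<theta> - sin \<theta>'\<bar> \<le> h"
      using h by (simp_all flip: abs_le_square_iff)
  qed
  ultimately show ?thesis
    using h \<theta> \<theta>'
    by (intro exI[of _ "cos \<theta>'"] exI[of _ "sin \<theta>'"]) (auto simp: cos_ge_zero sin_ge_zero)
qed

text \<open>
  The slice of \<open>g\<close> forces the pair \<open>(p, q)\<close> of coordinate norms of its points close to \<open>(s, t)\<close>, by uniform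
  convexity of the disc. Therefore \<open>a p + b q\<close> is bounded away from 1, and
  \<open>\<parallel>x - y\<parallel>\<^sup>2 \<le> (a + p)\<^sup>2 + (b + q)\<^sup>2 \<le> 2 + 2 (a p + b q)\<close> is bounded away from 4. The slice of \<open>g\<close> is
  contained in that of \<open>f\<close> because \<open>f\<close> and \<open>g\<close> differ by at most \<open>\<alpha> / 2\<close> on the ball.
\<close>

lemma l2_sum_slice_away_from_antipode:
  fixes f :: "'a::real_normed_vector \<times> 'b::real_normed_vector \<Rightarrow> real"
  assumes f: "bounded_linear f" and f_le: "\<And>w. f w \<le> norm w"
    and x: "norm x = 1" "f x = 1" and "0 < \<alpha>"
    and ex: "\<exists>U F. norming_pair (U :: 'a) F" "\<exists>V G. norming_pair (V :: 'b) G"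
  shows "\<exists>g w \<epsilon> \<delta>. norming_pair w g \<and> 0 < \<epsilon> \<and> 0 < \<delta> \<and>
     (\<forall>y. norm y \<le> 1 \<longrightarrow> 1 - \<epsilon> < g y \<longrightarrow> 1 - \<alpha> < f y \<and> norm (x - y) \<le> 2 - \<delta>)"
proof -
  interpret f: bounded_linear f by fact
  obtain u v where uv: "x = (u, v)" by (cases x)
  define a b where "a = norm u" and "b = norm v"
  have ab: "0 \<le> a" "0 \<le> b" "a\<^sup>2 + b\<^sup>2 = 1"
    using x(1) by (simp_all add: uv norm_Pair a_def b_def)
  note supp = l2_sum_supporting_functional[OF f f_le x[unfolded uv]]
  have "bounded_linear (\<lambda>y. f (y, 0))" "bounded_linear (\<lambda>z. f (0, z))"
    by (intro bounded_linear_compose[OF f] bounded_linear_Pair bounded_linear_ident bounded_linear_zero)+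
  from normalise_functional[OF this(1) supp(1,3) ex(1)] normalise_functional[OF this(2) supp(2,4) ex(2)]
  obtain U F V G where F: "norming_pair U F" "\<And>y. f (y, 0) = a * F y"
    and G: "norming_pair V G" "\<And>z. f (0, z) = b * G z"
    unfolding a_def b_def by blast
  have f_eq: "f y = a * F (fst y) + b * G (snd y)" for y
    using f.add[of "(fst y, 0)" "(0, snd y)"] F(2) G(2) by simp
  obtain s t where st: "0 \<le> s" "0 \<le> t" "s\<^sup>2 + t\<^sup>2 = 1" "a * s + b * t < 1" "\<bar>a - s\<bar> + \<bar>b - t\<bar> \<le> \<alpha> / 2"
    using ex_nearby_point_on_quarter_circle[OF ab, of "\<alpha> / 2"] \<open>0 < \<alpha>\<close> by auto
  define g where "g y = s * F (fst y) + t * G (snd y)" for y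
  have F_le: "\<bar>F y\<bar> \<le> norm y" and G_le: "\<bar>G z\<bar> \<le> norm z" for y z
    using F(1) G(1) by (auto simp: norming_pair_def)
  have g_le: "\<bar>g y\<bar> \<le> s * norm (fst y) + t * norm (snd y)" for y
  proof -
    have "\<bar>g y\<bar> \<le> s * \<bar>F (fst y)\<bar> + t * \<bar>G (snd y)\<bar>"
      unfolding g_def using st by (metis abs_mult abs_of_nonneg abs_triangle_ineq)
    then show ?thesis
      using mult_left_mono[OF F_le[of "fst y"] st(1)] mult_left_mono[OF G_le[of "snd y"] st(2)] by linarith
  qed
  have g_norming: "norming_pair (s *\<^sub>R U, t *\<^sub>R V) g"
    unfolding norming_pair_def
  proof (intro conjI allI)
    have FG: "bounded_linear F" "bounded_linear G" using F(1) G(1) by (auto simp: norming_pair_def)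
    show "bounded_linear g"
      unfolding g_def
      by (intro bounded_linear_add bounded_linear_const_mult bounded_linear_compose[OF FG(1)]
          bounded_linear_compose[OF FG(2)] bounded_linear_fst bounded_linear_snd)
    show "norm (s *\<^sub>R U, t *\<^sub>R V) = 1"
      using F(1) G(1) st by (simp add: norming_pair_def norm_Pair)
    show "g (s *\<^sub>R U, t *\<^sub>R V) = 1"
      using F(1) G(1) st FG by (simp add: norming_pair_def g_def linear_simps power2_eq_square)
    fix y :: "'a \<times> 'b"
    have "s * norm (fst y) + t * norm (snd y) = (s, t) \<bullet> (norm (fst y), norm (snd y))" by simp
    also have "\<dots> \<le> norm (s, t) * norm (norm (fst y), norm (snd y))"
      by (rule norm_cauchy_schwarz)
    also have "\<dots> = norm y" using st by (simp add: norm_Pair norm_prod_def)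
    finally show "\<bar>g y\<bar> \<le> norm y" using g_le[of y] by simp
  qed
  \<comment> \<open>Half of the gap between \<open>a s + b t\<close> and 1 is spent on the distance of \<open>(p, q)\<close> from \<open>(s, t)\<close>, whose
    square is less than \<open>2 \<epsilon>\<close> on the slice of \<open>g\<close>; the other half remains as the gap for \<open>a p + b q\<close>.\<close>
  define \<kappa> where "\<kappa> = (1 - (a * s + b * t)) / 2"
  have \<kappa>: "0 < \<kappa>" using st by (simp add: \<kappa>_def)
  define \<epsilon> where "\<epsilon> = min (\<alpha> / 2) (\<kappa>\<^sup>2 / 2)"
  have \<epsilon>: "0 < \<epsilon>" "\<epsilon> \<le> \<alpha> / 2" "2 * \<epsilon> \<le> \<kappa>\<^sup>2" using \<kappa> \<open>0 < \<alpha>\<close> by (auto simp: \<epsilon>_def min_def)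
  define \<delta> where "\<delta> = \<kappa> / 2"
  have ast: "0 \<le> a * s + b * t" using ab st by simp
  have \<kappa>1: "\<kappa> \<le> 1/2" using ast by (simp add: \<kappa>_def)
  have "1 - \<alpha> < f y \<and> norm (x - y) \<le> 2 - \<delta>" if y: "norm y \<le> 1" "1 - \<epsilon> < g y" for y
  proof
    define p q where "p = norm (fst y)" and "q = norm (snd y)"
    have pq: "0 \<le> p" "0 \<le> q" "p\<^sup>2 + q\<^sup>2 \<le> 1"
      using y(1) by (auto simp: p_def q_def norm_prod_def)
    have pq1: "p \<le> 1" "q \<le> 1" 
      using y(1) norm_fst_le[of "fst y" "snd y"] norm_snd_le[of "snd y" "fst y"]
      by (auto simp: p_def q_def)
    have "g y - f y = (s - a) * F (fst y) + (t - b) * G (snd y)"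
      by (simp add: f_eq g_def algebra_simps)
    also have "\<dots> \<le> \<bar>s - a\<bar> * \<bar>F (fst y)\<bar> + \<bar>t - b\<bar> * \<bar>G (snd y)\<bar>"
      by (intro add_mono) (simp_all flip: abs_mult)
    also have "\<dots> \<le> \<bar>s - a\<bar> * 1 + \<bar>t - b\<bar> * 1"
      using F_le[of "fst y"] G_le[of "snd y"] pq1
      by (intro add_mono mult_left_mono) (auto simp: p_def q_def)
    also have "\<dots> \<le> \<alpha> / 2" using st(5) by (simp add: abs_minus_commute)
    finally show "1 - \<alpha> < f y" using y(2) \<epsilon> by simp
    have spq: "1 - \<epsilon> < s * p + t * q" using g_le[of y] y(2) by (simp add: p_def q_def)
    have "(norm ((p, q) - (s, t)))\<^sup>2 = (p - s)\<^sup>2 + (q - t)\<^sup>2"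
      by (simp add: norm_Pair)
    also have "\<dots> = (p\<^sup>2 + q\<^sup>2) + (s\<^sup>2 + t\<^sup>2) - 2 * (s * p + t * q)"
      by (simp add: power2_diff algebra_simps)
    also have "\<dots> \<le> \<kappa>\<^sup>2" using pq st spq \<epsilon> by simp
    finally have "norm ((p, q) - (s, t)) \<le> \<kappa>"
      by (rule power2_le_imp_le) (use \<kappa> in simp)
    moreover have "(a, b) \<bullet> ((p, q) - (s, t)) \<le> norm (a, b) * norm ((p, q) - (s, t))"
      by (rule norm_cauchy_schwarz)
    ultimately have "a * p + b * q \<le> a * s + b * t + \<kappa>"
      using ab by (simp add: norm_Pair algebra_simps)
    then have apq: "a * p + b * q \<le> 1 - \<kappa>" by (simp add: \<kappa>_def field_simps)
    have "(norm (x - y))\<^sup>2 = (norm (u - fst y))\<^sup>2 + (norm (v - snd y))\<^sup>2"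
      by (simp add: uv norm_prod_def)
    also have "\<dots> \<le> (a + p)\<^sup>2 + (b + q)\<^sup>2"
      unfolding a_def b_def p_def q_def by (intro add_mono power_mono norm_triangle_ineq4) auto
    also have "\<dots> = (a\<^sup>2 + b\<^sup>2) + (p\<^sup>2 + q\<^sup>2) + 2 * (a * p + b * q)"
      by (simp add: power2_sum algebra_simps)
    also have "\<dots> \<le> 4 - 2 * \<kappa>" using ab pq apq by simp
    also have "\<dots> \<le> (2 - \<delta>)\<^sup>2" using \<kappa> by (simp add: \<delta>_def power2_diff)
    finally show "norm (x - y) \<le> 2 - \<delta>"
      by (rule power2_le_imp_le) (use \<kappa>1 in \<open>simp add: \<delta>_def\<close>)
  qed
  moreover have "0 < \<delta>" using \<kappa> by (simp add: \<delta>_def)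
  ultimately show ?thesis using g_norming \<epsilon>(1) by blast
qed

section \<open>Transport of a Banach space along an injection\<close>

definition transported :: "('b::real_normed_vector \<Rightarrow> 'a) \<Rightarrow> 'a normed_module" where
  "transported e = \<lparr>carrier = range e, monoid.mult = undefined, one = undefined,
     zero = e 0, add = (\<lambda>x y. e (inv_into UNIV e x + inv_into UNIV e y)),
     smult = (\<lambda>c x. e (c *\<^sub>R inv_into UNIV e x)), vnorm = (\<lambda>x. norm (inv_into UNIV e x))\<rparr>"

context
  fixes e :: "'b::banach \<Rightarrow> 'a"
  assumes inj: "inj e"
begin

lemma transported_simps:
  "carrier (transported e) = range e"
  "\<zero>\<^bsub>transported e\<^esub> = e 0"
  "e y \<oplus>\<^bsub>transported e\<^esub> e z = e (y + z)"
  "c \<odot>\<^bsub>transported e\<^esub> e y = e (c *\<^sub>R y)"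
  "vnorm (transported e) (e y) = norm y"
  using inj by (auto simp: transported_def)

lemma abelian_group_transported: "abelian_group (transported e)"
proof (rule abelian_groupI)
  fix x assume "x \<in> carrier (transported e)"
  then obtain y where "x = e y" by (auto simp: transported_simps)
  then show "\<exists>y\<in>carrier (transported e). y \<oplus>\<^bsub>transported e\<^esub> x = \<zero>\<^bsub>transported e\<^esub>"
    by (intro bexI[of _ "e (- y)"]) (auto simp: transported_simps)
qed (auto simp: transported_simps algebra_simps)

lemma transported_minus:
  "e y \<ominus>\<^bsub>transported e\<^esub> e z = e (y - z)"
proof -
  interpret abelian_group "transported e" by (rule abelian_group_transported)
  have "\<ominus>\<^bsub>transported e\<^esub> e z = e (- z)"
    by (rule minus_equality) (auto simp: transported_simps)
  then show ?thesis by (simp add: a_minus_def transported_simps)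
qed

lemma cring_real_ring: "cring real_ring"
proof (rule cringI)
  show "abelian_group real_ring"
  proof (rule abelian_groupI)
    fix x :: real
    show "\<exists>y\<in>carrier real_ring. y \<oplus>\<^bsub>real_ring\<^esub> x = \<zero>\<^bsub>real_ring\<^esub>"
      by (rule bexI[of _ "- x"]) (auto simp: real_ring_def)
  qed (auto simp: real_ring_def)
  show "comm_monoid real_ring"
    by (rule comm_monoidI) (auto simp: real_ring_def)
qed (auto simp: real_ring_def algebra_simps)

lemma normed_space_transported: "normed_space (transported e)"
proof -
  have "Module.module real_ring (transported e)"
    by (rule moduleI[OF cring_real_ring abelian_group_transported])
      (auto simp: transported_simps real_ring_def algebra_simps)
  then show ?thesis
    by (intro normed_space.intro normed_space_axioms.intro)
      (use inj in \<open>auto simp: transported_simps inj_eq norm_triangle_ineq\<close>)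
qed

lemma banach_space_transported: "banach_space (transported e)"
proof (intro banach_space.intro normed_space_transported banach_space_axioms.intro)
  fix u :: "nat \<Rightarrow> 'a"
  assume u: "\<And>n. u n \<in> carrier (transported e)"
    and cauchy: "\<And>\<epsilon>. 0 < \<epsilon> \<Longrightarrow>
      \<exists>N. \<forall>m\<ge>N. \<forall>n\<ge>N. vnorm (transported e) (u m \<ominus>\<^bsub>transported e\<^esub> u n) < \<epsilon>"
  define w where "w n = inv_into UNIV e (u n)" for n
  have uw: "u n = e (w n)" for n
    using u[of n] by (auto simp: w_def transported_simps f_inv_into_f)
  have "Cauchy w"
    by (rule CauchyI) (use cauchy in \<open>simp add: uw transported_minus transported_simps\<close>)
  then obtain l where "w \<longlonglongrightarrow> l" using Cauchy_convergent convergent_def by blast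
  then have "(\<lambda>n. norm (w n - l)) \<longlonglongrightarrow> 0"
    by (simp add: LIM_zero_iff tendsto_norm_zero_iff)
  then show "\<exists>l\<in>carrier (transported e).
      (\<lambda>n. vnorm (transported e) (u n \<ominus>\<^bsub>transported e\<^esub> l)) \<longlonglongrightarrow> 0"
    by (intro bexI[of _ "e l"]) (auto simp: uw transported_minus transported_simps)
qed

lemma unit_ball_transported: "unit_ball (transported e) = e ` cball 0 1"
  by (auto simp: unit_ball_def transported_simps)

lemma unit_sphere_transported: "unit_sphere (transported e) = e ` sphere 0 1"
  by (auto simp: unit_sphere_def transported_simps)

lemma dual_space_transported:
  "f \<in> dual_space (transported e) \<longleftrightarrow> bounded_linear (f \<circ> e)"
proof
  assume f: "f \<in> dual_space (transported e)"
  then obtain K where "\<And>y. \<bar>f (e y)\<bar> \<le> K * norm y"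
    by (auto simp: dual_space_def transported_simps)
  then show "bounded_linear (f \<circ> e)"
    using f by (intro bounded_linear_intro[where K = K])
      (auto simp: dual_space_def transported_simps mult.commute)
next
  assume "bounded_linear (f \<circ> e)"
  then interpret f: bounded_linear "f \<circ> e" .
  obtain K where "\<And>y. norm ((f \<circ> e) y) \<le> norm y * K" using f.bounded by blast
  then show "f \<in> dual_space (transported e)"
    using f.add f.scaleR
    by (auto simp: dual_space_def transported_simps mult.commute intro!: exI[of _ K])
qed

lemma slice_transported:
  "slice (transported e) f \<alpha> =
     e ` {y \<in> cball 0 1. (SUP z\<in>cball 0 1. f (e z)) - \<alpha> < f (e y)}"
  by (auto simp: slice_def unit_ball_transported image_image)

text \<open>
  If \<open>x\<close> is in a slice of \<open>f\<close> and \<open>f \<phi>\<close> is small, then \<open>x - 2 \<phi>\<close> is still in that slice.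
\<close>

lemma DLD2P_transportedI:
  assumes nz: "(w :: 'b) \<noteq> 0"
    and antipodes: "\<And>x :: 'b. weakly_close_antipodes x"
  shows "DLD2P (transported e)"
  unfolding DLD2P_def
proof (intro conjI ballI)
  show "carrier (transported e) \<noteq> {\<zero>\<^bsub>transported e\<^esub>}"
  proof -
    have "e w \<in> range e" "e w \<noteq> e 0" using nz inj by (auto simp: inj_eq)
    then show ?thesis unfolding transported_simps by blast
  qed
  fix x' assume x': "x' \<in> unit_sphere (transported e)"
  then obtain x where x: "x' = e x" "norm x = 1" by (auto simp: unit_sphere_transported)
  show "delta_point (transported e) x'"
    unfolding delta_point_def
  proof (intro conjI allI impI x')
    fix T assume T: "is_slice (transported e) T \<and> x' \<in> T"
    then obtain f \<alpha> where f: "bounded_linear (f \<circ> e)" and "0 < \<alpha>" and T_eq: "T = slice (transported e) f \<alpha>"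
      by (auto simp: is_slice_def dual_space_transported)
    interpret f: bounded_linear "f \<circ> e" by fact
    define \<sigma> where "\<sigma> = (SUP z\<in>cball 0 1. f (e z))"
    define D where "D = {y \<in> cball 0 1. \<sigma> - \<alpha> < f (e y)}"
    have TD: "T = e ` D" by (simp add: T_eq slice_transported D_def \<sigma>_def)
    have xD: "x \<in> D" using T inj x by (auto simp: TD inj_eq)
    have "(SUP y\<in>D. norm (x - y)) = 2"
    proof (rule cSup_eq)
      fix r assume "r \<in> (\<lambda>y. norm (x - y)) ` D"
      then obtain y where "r = norm (x - y)" "norm y \<le> 1" by (auto simp: D_def)
      then show "r \<le> 2" using x(2) norm_triangle_ineq4[of x y] by simp
    next
      fix r assume r: "\<And>q. q \<in> (\<lambda>y. norm (x - y)) ` D \<Longrightarrow> q \<le> r"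
      show "2 \<le> r"
      proof (rule field_le_epsilon)
        fix \<eta> :: real assume "0 < \<eta>"
        define \<epsilon> where "\<epsilon> = min 1 (\<eta> / 2)"
        have \<epsilon>: "0 < \<epsilon>" "\<epsilon> \<le> 1" "2 * \<epsilon> \<le> \<eta>" using \<open>0 < \<eta>\<close> by (auto simp: \<epsilon>_def)
        have "0 < (f (e x) - (\<sigma> - \<alpha>)) / 2" using xD by (simp add: D_def)
        from weakly_close_antipodesD[OF antipodes f \<epsilon>(1,2) this, of x]
        obtain \<phi> where \<phi>: "\<bar>f (e \<phi>)\<bar> < (f (e x) - (\<sigma> - \<alpha>)) / 2"
          "norm (x - 2 *\<^sub>R \<phi>) \<le> 1" "1 - \<epsilon> \<le> norm \<phi>"
          using x(2) by auto
        have "f (e (x - 2 *\<^sub>R \<phi>)) = f (e x) - 2 * f (e \<phi>)"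
          using f.diff[of x "2 *\<^sub>R \<phi>"] f.scaleR[of 2 \<phi>] by simp
        then have "x - 2 *\<^sub>R \<phi> \<in> D" using \<phi> by (auto simp: D_def)
        from r[OF imageI[OF this]] have "2 * norm \<phi> \<le> r" by simp
        then show "2 \<le> r + \<eta>" using \<phi>(3) \<epsilon> by linarith
      qed
    qed
    then show "(SUP y\<in>T. vnorm (transported e) (x' \<ominus>\<^bsub>transported e\<^esub> y)) = 2"
      by (simp add: TD image_image x transported_minus transported_simps)
  qed
qed

text \<open>
  A slice on which the distance to \<open>x\<close> stays below 2 refutes the relative Daugavet property at \<open>x\<close> for
  every supporting slice that contains it. As \<open>g\<close> attains its norm 1, its slices are cut out by
  \<open>g y > 1 - \<epsilon>\<close> and are nonempty.
\<close>

lemma not_relative_daugavet_point_transportedI: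
  assumes away: "\<And>(f :: 'b \<Rightarrow> real) x \<alpha>. bounded_linear f \<Longrightarrow> (\<And>w. f w \<le> norm w) \<Longrightarrow> norm x = 1 \<Longrightarrow>
      f x = 1 \<Longrightarrow> 0 < \<alpha> \<Longrightarrow>
      \<exists>g w \<epsilon> \<delta>. norming_pair (w :: 'b) g \<and> 0 < \<epsilon> \<and> 0 < \<delta> \<and>
       (\<forall>y. norm y \<le> 1 \<longrightarrow> 1 - \<epsilon> < g y \<longrightarrow> 1 - \<alpha> < f y \<and> norm (x - y) \<le> 2 - \<delta>)"
  shows "\<not> relative_daugavet_point (transported e) x'"
proof
  assume "relative_daugavet_point (transported e) x'"
  then obtain f \<alpha> where x': "x' \<in> unit_sphere (transported e)"
    and supp: "f \<in> supporting_functionals (transported e) x'" and "0 < \<alpha>"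
    and daug: "\<And>T. is_slice (transported e) T \<Longrightarrow> T \<subseteq> slice (transported e) f \<alpha> \<Longrightarrow>
      (SUP y\<in>T. vnorm (transported e) (x' \<ominus>\<^bsub>transported e\<^esub> y)) = 2"
    unfolding relative_daugavet_point_def daugavet_point_relative_to_def is_supporting_slice_def
    by blast
  obtain x where x: "x' = e x" "norm x = 1" using x' by (auto simp: unit_sphere_transported)
  have f: "bounded_linear (f \<circ> e)" and fx: "f (e x) = 1"
    and f_norm: "(SUP z\<in>cball 0 1. \<bar>f (e z)\<bar>) = 1"
    using supp x by (auto simp: supporting_functionals_def dual_space_transported dual_norm_def
        unit_ball_transported image_image)
  interpret f: bounded_linear "f \<circ> e" by fact
  obtain K where K: "0 < K" "\<And>y. norm ((f \<circ> e) y) \<le> norm y * K" using f.pos_bounded by blast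
  have "bdd_above ((\<lambda>z. \<bar>f (e z)\<bar>) ` cball 0 1)"
  proof (rule bdd_aboveI2)
    fix z :: 'b assume "z \<in> cball 0 1"
    then have "norm z * K \<le> 1 * K" using K(1) by (intro mult_right_mono) auto
    then show "\<bar>f (e z)\<bar> \<le> K" using K(2)[of z] by simp
  qed
  then have f_le1: "\<bar>f (e z)\<bar> \<le> 1" if "norm z \<le> 1" for z
    using cSUP_upper[of z "cball 0 1" "\<lambda>z. \<bar>f (e z)\<bar>"] that f_norm by auto
  have f_le: "(f \<circ> e) w \<le> norm w" for w
    using linear_bound_from_unit_ball[OF f, of 1 w] f_le1 by auto
  have f_sup: "(SUP z\<in>cball 0 1. f (e z)) = 1"
    by (rule cSup_eq_maximum) (use f_le1 x fx in \<open>force+\<close>)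
  have "(f \<circ> e) x = 1" using fx by simp
  from away[OF f f_le x(2) this \<open>0 < \<alpha>\<close>]
  obtain g w \<epsilon> \<delta> where g: "norming_pair w g" and "0 < \<epsilon>" "0 < \<delta>"
    and sub: "\<And>y. norm y \<le> 1 \<Longrightarrow> 1 - \<epsilon> < g y \<Longrightarrow> 1 - \<alpha> < f (e y) \<and> norm (x - y) \<le> 2 - \<delta>"
    by auto
  define D where "D = {y \<in> cball 0 1. 1 - \<epsilon> < g y}"
  have wD: "w \<in> D" using g \<open>0 < \<epsilon>\<close> by (auto simp: D_def norming_pair_def)
  have ge: "g \<circ> inv_into UNIV e \<circ> e = g" using inj by (simp add: comp_assoc)
  have "g z \<le> 1" if "norm z \<le> 1" for z
    using g that by (auto simp: norming_pair_def dest!: spec[of _ z])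
  moreover have "norm w = 1" "g w = 1" using g by (auto simp: norming_pair_def)
  ultimately have "(SUP z\<in>cball 0 1. g z) = 1"
    by (intro cSup_eq_maximum) force+
  then have slice_g: "slice (transported e) (g \<circ> inv_into UNIV e) \<epsilon> = e ` D"
    using inj by (simp add: slice_transported D_def)
  have "is_slice (transported e) (e ` D)"
    unfolding is_slice_def slice_g[symmetric]
    using g \<open>0 < \<epsilon>\<close> ge by (auto simp: dual_space_transported norming_pair_def)
  moreover have "e ` D \<subseteq> slice (transported e) f \<alpha>"
    using sub by (auto simp: slice_transported f_sup D_def)
  ultimately have "(SUP y\<in>e ` D. vnorm (transported e) (x' \<ominus>\<^bsub>transported e\<^esub> y)) = 2"
    by (rule daug)
  then have "(SUP y\<in>D. norm (x - y)) = 2"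
    by (simp add: image_image x transported_minus transported_simps)
  moreover have "(SUP y\<in>D. norm (x - y)) \<le> 2 - \<delta>"
    using wD sub by (intro cSUP_least) (auto simp: D_def)
  ultimately show False using \<open>0 < \<delta>\<close> by simp
qed

end

section \<open>The example\<close>

instance bcontfun :: (metric_space, banach) banach ..

lemma ex_norming_pair_bcontfun: "\<exists>U F. norming_pair (U :: real \<Rightarrow>\<^sub>C real) F"
proof (intro exI)
  have one: "norm (const_bcontfun 1 :: real \<Rightarrow>\<^sub>C real) = 1"
  proof (rule antisym)
    show "norm (const_bcontfun 1 :: real \<Rightarrow>\<^sub>C real) \<le> 1" by (rule norm_bound) simp
    show "1 \<le> norm (const_bcontfun 1 :: real \<Rightarrow>\<^sub>C real)"
      using norm_bounded[of "const_bcontfun 1 :: real \<Rightarrow>\<^sub>C real" 0] by simp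
  qed
  have ev: "\<bar>u 0\<bar> \<le> norm u" for u :: "real \<Rightarrow>\<^sub>C real"
    using norm_bounded[of u 0] by simp
  show "norming_pair (const_bcontfun 1 :: real \<Rightarrow>\<^sub>C real) (\<lambda>u. u 0)"
    unfolding norming_pair_def
  proof (intro conjI allI)
    show "bounded_linear (\<lambda>u :: real \<Rightarrow>\<^sub>C real. u 0)"
      by (rule bounded_linear_intro[where K = 1]) (use ev in auto)
  qed (use one ev in auto)
qed

text \<open>The two functions are squeezed into the two half-lines.\<close>

lemma ex_inj_bcontfun_pair:
  "\<exists>e :: (real \<Rightarrow>\<^sub>C real) \<times> (real \<Rightarrow>\<^sub>C real) \<Rightarrow> real \<Rightarrow> real. inj e"
proof (intro exI injI)
  let ?e = "\<lambda>p :: (real \<Rightarrow>\<^sub>C real) \<times> (real \<Rightarrow>\<^sub>C real).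
    \<lambda>t. if 0 < t then apply_bcontfun (fst p) (ln t) else apply_bcontfun (snd p) (ln (- t))"
  fix p q assume eq: "?e p = ?e q"
  have "apply_bcontfun (fst p) t = apply_bcontfun (fst q) t"
    "apply_bcontfun (snd p) t = apply_bcontfun (snd q) t" for t
    using fun_cong[OF eq, of "exp t"] fun_cong[OF eq, of "- exp t"] by (auto split: if_splits)
  then show "p = q" by (auto simp: prod_eq_iff bcontfun_eqI)
qed

theorem corollary3p39:
  shows "\<exists>X :: (real \<Rightarrow> real) normed_module.
           banach_space X \<and> DLD2P X \<and> \<not> (\<exists>x. relative_daugavet_point X x)"
proof -
  obtain e :: "(real \<Rightarrow>\<^sub>C real) \<times> (real \<Rightarrow>\<^sub>C real) \<Rightarrow> real \<Rightarrow> real" where e: "inj e"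
    using ex_inj_bcontfun_pair by blast
  obtain U :: "real \<Rightarrow>\<^sub>C real" and F where "norming_pair U F" using ex_norming_pair_bcontfun by blast
  then have "(U, 0 :: real \<Rightarrow>\<^sub>C real) \<noteq> 0" by (auto simp: norming_pair_def zero_prod_def)
  then have "DLD2P (transported e)"
    by (rule DLD2P_transportedI[OF e])
      (metis surj_pair weakly_close_antipodes_Pair weakly_close_antipodes_bcontfun)
  moreover have "\<not> relative_daugavet_point (transported e) x" for x
    by (rule not_relative_daugavet_point_transportedI[OF e])
      (rule l2_sum_slice_away_from_antipode[OF _ _ _ _ _ ex_norming_pair_bcontfun ex_norming_pair_bcontfun])
  ultimately show ?thesis using banach_space_transported[OF e] by blast
qed

end
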